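(* Let $u,v\in\ell^+$. The inequality \[ \sup_{n\ge1}\Big|\Big(\sum_{k=n}^\infty\frac{x_k}k\Big)-x_n\Big|v_n\le A\sup_{k\ge1}\frac{|x_k|}{u_k} \] holds for all real sequences $x\in\mathcal D(C^* )$ with $A=A(C^*-I)$; for all nonnegative sequences $x\in\mathcal D(C^* )$ with $A=A^+(C^*-I)$; and for all nonnegative, nondecreasing sequences $x\in\mathcal D(C^* )$ with $A=A^\uparrow(C^*-I)$. In each case the constant $A$ is best possible (the least in $[0,\infty]$). Here \begin{align*} A(C^*-I)&=\||C^*-I|u\|_{\ell^\infty(v)}=\sup_{n\ge1}v_n\Big(\frac{n-1}nu_n+\sum_{k=n+1}^\infty\frac{u_k}k\Big);\\ A^+(C^*-I)&=\max(\|(C^*-I)^+u\|_{\ell^\infty(v)},\|(C^*-I)^-u\|_{\ell^\infty(v)})=\sup_{n\ge1}v_n\max\Big(\frac{n-1}nu_n,\sum_{k=n+1}^{\infty}\frac{u_k}k\Big);\\ A^\uparrow(C^*-I)&=0. \end{align*}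
   Context: $\ell^+$ is the set of nonnegative real sequences indexed by the positive integers. $C^*$ is the upper triangular matrix with entries $1/k$ in row $n$, columns $k\ge n$; $I$ is the identity matrix. $\mathcal D(C^* )$ is the set of all real sequences $x$ for which $\sum_{k=1}^\infty\frac{x_k}k$ converges (possibly conditionally) in $\mathbb R$. For a real matrix $B=(b_{n,k})$, $|B|=(|b_{n,k}|)$, $B^\pm=((|b_{n,k}|\pm b_{n,k})/2)$, and $(Bx)_n=\sum_k b_{n,k}x_k$ (value $\infty$ allowed when $B$ and $x$ are nonnegative). $\|y\|_{\ell^\infty(v)}=\sup_n|y_n|v_n$. If $u_k=0$, then $|x_k|/u_k$ is $0$ when $x_k=0$ and $\infty$ when $x_k\ne0$. Suprema take values in $[0,\infty]$. Conventions: $\infty\cdot0=0$ in products with $v_n$ and when $A=\infty$ and the supremum on the right is $0$; the inequality is regarded as holding whenever the supremum on the right-hand side is $\infty$ (even if $A=0$). *)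

theory Defs
  imports Complex_Main "HOL-Library.Extended_Nonnegative_Real"
begin

text \<open>
  Sequences indexed by the positive integers are functions on \<^typ>\<open>nat\<close>, and matrices are functions
  \<^typ>\<open>nat \<Rightarrow> nat \<Rightarrow> real\<close>; only the values at indices \<open>\<ge> 1\<close> are ever used.
  Values in \<open>[0,\<infinity>]\<close> live in \<^typ>\<open>ennreal\<close>, whose arithmetic provides the conventions
  \<open>\<infinity> * 0 = 0\<close>, \<open>0 / 0 = 0\<close> and \<open>a / 0 = \<infinity>\<close> for \<open>a \<noteq> 0\<close>.
\<close>

definition ell_plus :: "(nat \<Rightarrow> real) set" where
  "ell_plus = {u. \<forall>k\<ge>1. 0 \<le> u k}"

type_synonym rmat = "nat \<Rightarrow> nat \<Rightarrow> real"

definition C_star :: rmat where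
  "C_star n k = (if n \<le> k then 1 / real k else 0)"

definition id_mat :: rmat where
  "id_mat n k = (if n = k then 1 else 0)"

definition abs_mat :: "rmat \<Rightarrow> rmat" where
  "abs_mat B n k = \<bar>B n k\<bar>"

definition pos_mat :: "rmat \<Rightarrow> rmat" where
  "pos_mat B n k = (\<bar>B n k\<bar> + B n k) / 2"

definition neg_mat :: "rmat \<Rightarrow> rmat" where
  "neg_mat B n k = (\<bar>B n k\<bar> - B n k) / 2"

text \<open>
  The product \<open>Bx\<close> with values in \<open>[0,\<infinity>]\<close>, meant for nonnegative \<open>B\<close> and \<open>x\<close> only
  (\<^const>\<open>ennreal\<close> sends negative reals to \<open>0\<close>).
\<close>
definition nn_mult :: "rmat \<Rightarrow> (nat \<Rightarrow> real) \<Rightarrow> nat \<Rightarrow> ennreal" where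
  "nn_mult B x n = (\<Sum>j. ennreal (B n (Suc j) * x (Suc j)))"

text \<open>The norm of \<open>\<ell>\<^sup>\<infinity>(v)\<close>; the argument \<open>y\<close> is the sequence of absolute values.\<close>
definition linf_norm :: "(nat \<Rightarrow> real) \<Rightarrow> (nat \<Rightarrow> ennreal) \<Rightarrow> ennreal" where
  "linf_norm v y = (SUP n\<in>{1..}. y n * ennreal (v n))"

definition dom_C_star :: "(nat \<Rightarrow> real) set" where
  "dom_C_star = {x. summable (\<lambda>j. x (Suc j) / real (Suc j))}"

definition lhs_sup :: "(nat \<Rightarrow> real) \<Rightarrow> (nat \<Rightarrow> real) \<Rightarrow> ennreal" where
  "lhs_sup v x = linf_norm v (\<lambda>n. ennreal \<bar>(\<Sum>j. x (n + j) / real (n + j)) - x n\<bar>)"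

definition rhs_sup :: "(nat \<Rightarrow> real) \<Rightarrow> (nat \<Rightarrow> real) \<Rightarrow> ennreal" where
  "rhs_sup u x = (SUP k\<in>{1..}. ennreal \<bar>x k\<bar> / ennreal (u k))"

text \<open>
  The first disjunct is needed because \<open>0 * \<infinity> = 0\<close> in \<^typ>\<open>ennreal\<close>, whereas the inequality counts
  as true whenever the right-hand supremum is infinite, even for \<open>A = 0\<close>.
\<close>
definition ineq_holds :: "(nat \<Rightarrow> real) \<Rightarrow> (nat \<Rightarrow> real) \<Rightarrow> ennreal \<Rightarrow> (nat \<Rightarrow> real) \<Rightarrow> bool" where
  "ineq_holds u v A x \<longleftrightarrow> rhs_sup u x = \<infinity> \<or> lhs_sup v x \<le> A * rhs_sup u x"

definition best_constant ::
    "(nat \<Rightarrow> real) set \<Rightarrow> (nat \<Rightarrow> real) \<Rightarrow> (nat \<Rightarrow> real) \<Rightarrow> ennreal \<Rightarrow> bool" where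
  "best_constant X u v A \<longleftrightarrow>
     (\<forall>x\<in>X. ineq_holds u v A x) \<and>
     (\<forall>A'. (\<forall>x\<in>X. ineq_holds u v A' x) \<longrightarrow> A \<le> A')"

definition A_real :: "rmat \<Rightarrow> (nat \<Rightarrow> real) \<Rightarrow> (nat \<Rightarrow> real) \<Rightarrow> ennreal" where
  "A_real B u v = linf_norm v (nn_mult (abs_mat B) u)"

definition A_plus :: "rmat \<Rightarrow> (nat \<Rightarrow> real) \<Rightarrow> (nat \<Rightarrow> real) \<Rightarrow> ennreal" where
  "A_plus B u v = max (linf_norm v (nn_mult (pos_mat B) u)) (linf_norm v (nn_mult (neg_mat B) u))"

end

theory Submission
  imports Defs "HOL-Analysis.Summation_Tests"
begin

text \<open>
  Row \<open>n\<close> of \<open>C\<^sup>* - I\<close> has the nonpositive entry \<open>-(n - 1)/n\<close> on the diagonal, the positive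
  entries \<open>1/k\<close> for \<open>k > n\<close>, and zeros elsewhere. Hence, for \<open>x\<close> in the domain of \<open>C\<^sup>*\<close>, the number inside the
  absolute value on the left is \<open>T - D\<close> with \<open>T = \<Sum>k>n. x k / k\<close> and \<open>D = (n - 1)/n * x n\<close>.

  For finite \<open>r\<close>, the supremum on the right is at most \<open>r\<close> if and only if \<open>\<bar>x k\<bar> \<le> r * u k\<close> for all
  \<open>k\<close>. The left-hand side is a supremum over the rows, so the best constant is the supremum of \<open>v n\<close>
  times the best constant of row \<open>n\<close>, which is the supremum of \<open>\<bar>T - D\<bar>\<close> over the \<open>x\<close> of the class with \<open>\<bar>x\<bar> \<le> u\<close>
  (\<open>best_constant_rowwise\<close>). For real \<open>x\<close> the triangle inequality bounds \<open>\<bar>T - D\<bar>\<close> by the sum of the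
  diagonal and the tail contribution of \<open>u\<close>; giving \<open>x n\<close> the sign opposite to the tail attains it. For
  nonnegative \<open>x\<close> both \<open>T\<close> and \<open>D\<close> are nonnegative, so \<open>\<bar>T - D\<bar> \<le> max T D\<close>, and one attains the two
  terms separately by letting \<open>x\<close> live only on the diagonal or only to the right of it. Since the tail
  of \<open>u\<close> itself may have an infinite sum, the extremal sequences are truncated to finite support
  and one passes to the supremum over the truncations.

  For nonnegative nondecreasing \<open>x\<close> the class is trivial: \<open>x m > 0\<close> would make \<open>\<Sum>k. x k / k\<close>
  dominate a multiple of the harmonic series.
\<close>

section \<open>Nonnegative and signed series\<close>

text \<open>
  If the right-hand side is finite, \<open>f\<close> converges absolutely. The form with values in \<open>[0,\<infinity>]\<close> makes
  the bound available for the conditionally convergent series in the domain of \<open>C\<^sup>*\<close>.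
\<close>

lemma ennreal_abs_suminf_le:
  fixes f :: "nat \<Rightarrow> real"
  shows "ennreal \<bar>\<Sum>j. f j\<bar> \<le> (\<Sum>j. ennreal \<bar>f j\<bar>)"
proof (cases "(\<Sum>j. ennreal \<bar>f j\<bar>) = top")
  case False
  then have "summable (\<lambda>j. \<bar>f j\<bar>)"
    by (intro summable_suminf_not_top) auto
  then show ?thesis
    by (simp add: suminf_ennreal2 summable_rabs ennreal_leI)
qed simp

section \<open>The rows of the matrix\<close>

text \<open>
  Row \<open>n\<close> of \<open>(C\<^sup>* - I) x\<close>. It is the difference of a possibly conditionally convergent series and
  \<open>x n\<close>, as in the inequality, rather than one series over the matrix entries.
\<close>

definition deviation :: "(nat \<Rightarrow> real) \<Rightarrow> nat \<Rightarrow> real" where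
  "deviation x n = (\<Sum>j. x (n + j) / real (n + j)) - x n"

definition diagonal_part :: "(nat \<Rightarrow> real) \<Rightarrow> nat \<Rightarrow> ennreal" where
  "diagonal_part u n = ennreal ((real n - 1) / real n * u n)"

definition tail_part :: "(nat \<Rightarrow> real) \<Rightarrow> nat \<Rightarrow> ennreal" where
  "tail_part u n = (\<Sum>j. ennreal (u (n + 1 + j) / real (n + 1 + j)))"

lemma summable_tail:
  assumes "x \<in> dom_C_star"
  shows "summable (\<lambda>j. x (n + 1 + j) / real (n + 1 + j))"
proof -
  have "summable (\<lambda>j. x (Suc (j + n)) / real (Suc (j + n)))"
    using assms summable_iff_shift[of "\<lambda>j. x (Suc j) / real (Suc j)" n]
    by (simp add: dom_C_star_def)
  then show ?thesis by (simp add: add.commute)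
qed

text \<open>
  The first term \<open>x n / n\<close> of the series cancels part of \<open>x n\<close>, which separates the two signs
  occurring in the row.
\<close>

lemma deviation_split:
  assumes "x \<in> dom_C_star" and "1 \<le> n"
  shows "deviation x n
    = (\<Sum>j. x (n + 1 + j) / real (n + 1 + j)) - (real n - 1) / real n * x n"
proof -
  let ?f = "\<lambda>j. x (n + j) / real (n + j)"
  have "summable (\<lambda>j. ?f (Suc j))"
    using summable_tail[OF assms(1), of n] by simp
  then have "summable ?f"
    by (subst (asm) summable_Suc_iff)
  then have "(\<Sum>j. ?f j) = (\<Sum>j. ?f (Suc j)) + x n / real n"
    using suminf_split_head[of ?f] by simp
  then show ?thesis
    using assms(2) by (simp add: deviation_def field_simps)
qed

lemma nn_mult_upper_triangular:
  assumes "1 \<le> n" and "\<And>k. k < n \<Longrightarrow> B n k = 0"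
  shows "nn_mult B u n
    = ennreal (B n n * u n) + (\<Sum>j. ennreal (B n (n + 1 + j) * u (n + 1 + j)))"
proof -
  let ?f = "\<lambda>j. ennreal (B n (Suc j) * u (Suc j))"
  \<comment> \<open>Position \<open>j\<close> holds column \<open>j + 1\<close>, so the first \<open>n\<close> positions end with the diagonal entry.\<close>
  have "suminf ?f = (\<Sum>j. ?f (j + n)) + (\<Sum>j<n. ?f j)"
    by (intro suminf_offset summableI)
  moreover have "(\<Sum>j<n. ?f j) = ?f (n - 1)"
    using assms by (cases n) simp_all
  ultimately show ?thesis
    using assms(1) by (simp add: nn_mult_def add.commute)
qed

lemma C_star_minus_id_entries:
  "1 \<le> n \<Longrightarrow> (C_star - id_mat) n n = - ((real n - 1) / real n)"
  "n < k \<Longrightarrow> (C_star - id_mat) n k = 1 / real k"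
  "k < n \<Longrightarrow> (C_star - id_mat) n k = 0"
  by (auto simp: C_star_def id_mat_def field_simps)

lemma pos_mat_eq_max: "pos_mat B n k = max (B n k) 0"
  and neg_mat_eq_max: "neg_mat B n k = max (- B n k) 0"
  by (auto simp: pos_mat_def neg_mat_def)

lemma nn_mult_abs_mat:
  assumes "1 \<le> n"
  shows "nn_mult (abs_mat (C_star - id_mat)) u n = diagonal_part u n + tail_part u n"
  using assms
  by (simp add: nn_mult_upper_triangular abs_mat_def C_star_minus_id_entries diagonal_part_def
      tail_part_def del: minus_apply)

lemma nn_mult_pos_mat:
  assumes "1 \<le> n"
  shows "nn_mult (pos_mat (C_star - id_mat)) u n = tail_part u n"
  using assms
  by (simp add: nn_mult_upper_triangular pos_mat_eq_max C_star_minus_id_entries tail_part_def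
      max_absorb1 max_absorb2 del: minus_apply)

lemma nn_mult_neg_mat:
  assumes "1 \<le> n"
  shows "nn_mult (neg_mat (C_star - id_mat)) u n = diagonal_part u n"
  using assms
  by (simp add: nn_mult_upper_triangular neg_mat_eq_max C_star_minus_id_entries diagonal_part_def
      max_absorb1 max_absorb2 del: minus_apply)

lemma A_real_eq:
  "A_real (C_star - id_mat) u v
    = (SUP n\<in>{1..}. ennreal (v n) * (diagonal_part u n + tail_part u n))"
  by (simp add: A_real_def linf_norm_def nn_mult_abs_mat mult.commute)

lemma A_plus_eq:
  "A_plus (C_star - id_mat) u v
    = (SUP n\<in>{1..}. ennreal (v n) * max (diagonal_part u n) (tail_part u n))"
proof -
  \<comment> \<open>The order of the arguments is exchanged since \<open>A_plus\<close> lists the positive part, which is the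
    tail, first.\<close>
  have sup_scale: "c * sup a b = sup (c * b) (c * a)" for a b c :: ennreal
    by (cases "a \<le> b") (simp_all add: sup_absorb1 sup_absorb2 mult_left_mono)
  show ?thesis
    by (simp add: A_plus_def linf_norm_def nn_mult_pos_mat nn_mult_neg_mat mult.commute
        sup_scale SUP_sup_distrib flip: sup_max)
qed

section \<open>Sharp constants row by row\<close>

text \<open>
  Together with the next lemma, this translates bounds on the right-hand supremum into pointwise
  bounds. Where \<open>u k = 0\<close>, a finite quotient forces \<open>x k = 0\<close>.
\<close>

lemma rhs_sup_bounds:
  assumes "rhs_sup u x \<le> ennreal r" and "0 \<le> r" and "1 \<le> k" and "0 \<le> u k"
  shows "\<bar>x k\<bar> \<le> r * u k"
proof -
  have *: "ennreal \<bar>x k\<bar> / ennreal (u k) \<le> ennreal r"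
    using assms(1,3) unfolding rhs_sup_def by (auto simp: SUP_le_iff)
  show ?thesis
  proof (cases "u k = 0")
    case True
    then show ?thesis
      using * by (cases "x k = 0") (auto simp: ennreal_divide_zero top_unique)
  next
    case False
    then show ?thesis
      using * assms(2,4) by (simp add: divide_ennreal field_simps)
  qed
qed

lemma rhs_sup_le_one:
  assumes "\<And>k. 1 \<le> k \<Longrightarrow> \<bar>x k\<bar> \<le> u k"
  shows "rhs_sup u x \<le> 1"
  unfolding rhs_sup_def
proof (rule SUP_least)
  fix k :: nat
  assume "k \<in> {1..}"
  then have le: "\<bar>x k\<bar> \<le> u k" using assms by simp
  show "ennreal \<bar>x k\<bar> / ennreal (u k) \<le> 1"
  proof (cases "u k = 0")
    case False
    then have "0 < u k" using le by linarith
    then show ?thesis using le by (simp add: divide_ennreal)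
  qed (use le in simp)
qed

text \<open>
  The reduction to single rows. The inequality with constant \<open>SUP n. v n * c n\<close> follows from the row
  bounds \<open>r * c n\<close> by taking suprema. Conversely, any admissible constant bounds \<open>v n\<close> times the row
  value at each \<open>x\<close> with \<open>\<bar>x\<bar> \<le> u\<close>, because for such \<open>x\<close> the right-hand supremum is at most \<open>1\<close>. The
  sharpness assumption asks for a supremum only, since \<open>c n\<close> may be infinite and then no single
  sequence attains it.
\<close>

lemma best_constant_rowwise:
  assumes u: "u \<in> ell_plus"
    and upper: "\<And>x r n. \<lbrakk>x \<in> X; 1 \<le> n; 0 \<le> r; \<And>k. 1 \<le> k \<Longrightarrow> \<bar>x k\<bar> \<le> r * u k\<rbrakk>
      \<Longrightarrow> ennreal \<bar>deviation x n\<bar> \<le> ennreal r * c n"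
    and lower: "\<And>n. 1 \<le> n
      \<Longrightarrow> c n \<le> (SUP x\<in>{x \<in> X. \<forall>k\<ge>1. \<bar>x k\<bar> \<le> u k}. ennreal \<bar>deviation x n\<bar>)"
  shows "best_constant X u v (SUP n\<in>{1..}. ennreal (v n) * c n)"
  unfolding best_constant_def
proof (intro conjI ballI allI impI)
  let ?A = "SUP n\<in>{1..}. ennreal (v n) * c n"
  fix x assume x: "x \<in> X"
  show "ineq_holds u v ?A x"
  proof (cases "rhs_sup u x" rule: ennreal_cases)
    case (real r)
    have bound: "\<bar>x k\<bar> \<le> r * u k" if "1 \<le> k" for k
      using rhs_sup_bounds[of u x r k] real that u by (simp add: ell_plus_def)
    have "lhs_sup v x \<le> ?A * ennreal r"
      unfolding lhs_sup_def linf_norm_def deviation_def[symmetric]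
    proof (rule SUP_least)
      fix n :: nat assume n: "n \<in> {1..}"
      have "ennreal \<bar>deviation x n\<bar> * ennreal (v n) \<le> (ennreal r * c n) * ennreal (v n)"
        using upper[OF x _ real(1) bound] n by (intro mult_right_mono) auto
      also have "\<dots> = (ennreal (v n) * c n) * ennreal r"
        by (simp add: mult_ac)
      also have "\<dots> \<le> ?A * ennreal r"
        using n by (intro mult_right_mono SUP_upper) auto
      finally show "ennreal \<bar>deviation x n\<bar> * ennreal (v n) \<le> ?A * ennreal r" .
    qed
    then show ?thesis using real by (simp add: ineq_holds_def)
  qed (simp add: ineq_holds_def)
next
  fix A' assume A': "\<forall>x\<in>X. ineq_holds u v A' x"
  have test: "ennreal (v n) * ennreal \<bar>deviation x n\<bar> \<le> A'"
    if "x \<in> X" and "\<forall>k\<ge>1. \<bar>x k\<bar> \<le> u k" and "1 \<le> n" for x n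
  proof -
    have le1: "rhs_sup u x \<le> 1" using that(2) by (intro rhs_sup_le_one) simp
    then have "rhs_sup u x \<noteq> \<infinity>" by (auto simp: top_unique)
    then have "lhs_sup v x \<le> A' * rhs_sup u x"
      using A' that(1) by (auto simp: ineq_holds_def)
    also have "\<dots> \<le> A' * 1" using le1 by (intro mult_left_mono) auto
    finally have "lhs_sup v x \<le> A'" by simp
    moreover have "ennreal (v n) * ennreal \<bar>deviation x n\<bar> \<le> lhs_sup v x"
      unfolding lhs_sup_def linf_norm_def deviation_def[symmetric]
      using that(3) by (intro SUP_upper2[of n]) (auto simp: mult.commute)
    ultimately show ?thesis by simp
  qed
  show "(SUP n\<in>{1..}. ennreal (v n) * c n) \<le> A'"
  proof (rule SUP_least)
    fix n :: nat assume n: "n \<in> {1..}"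
    let ?T = "{x \<in> X. \<forall>k\<ge>1. \<bar>x k\<bar> \<le> u k}"
    have "ennreal (v n) * c n \<le> ennreal (v n) * (SUP x\<in>?T. ennreal \<bar>deviation x n\<bar>)"
      using lower[of n] n by (intro mult_left_mono) auto
    also have "\<dots> = (SUP x\<in>?T. ennreal (v n) * ennreal \<bar>deviation x n\<bar>)"
      by (rule SUP_mult_left_ennreal)
    also have "\<dots> \<le> A'"
      using test n by (intro SUP_least) auto
    finally show "ennreal (v n) * c n \<le> A'" .
  qed
qed

section \<open>Bounds for one row\<close>

lemma diagonal_le:
  assumes "1 \<le> n" and "\<bar>x n\<bar> \<le> r * u n" and "0 \<le> r"
  shows "ennreal \<bar>(real n - 1) / real n * x n\<bar> \<le> ennreal r * diagonal_part u n"
proof -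
  have "\<bar>(real n - 1) / real n * x n\<bar> = (real n - 1) / real n * \<bar>x n\<bar>"
    using assms(1) by (simp add: abs_mult)
  also have "\<dots> \<le> (real n - 1) / real n * (r * u n)"
    using assms by (intro mult_left_mono) auto
  also have "\<dots> = r * ((real n - 1) / real n * u n)" by simp
  finally show ?thesis
    unfolding diagonal_part_def using assms(3) by (metis ennreal_leI ennreal_mult')
qed

text \<open>
  The product on the right is taken in \<open>[0,\<infinity>]\<close>: for \<open>r = 0\<close> it vanishes even when the tail of \<open>u\<close> is
  infinite, which is right because then \<open>x = 0\<close>.
\<close>

lemma tail_le:
  assumes "\<And>k. 1 \<le> k \<Longrightarrow> \<bar>x k\<bar> \<le> r * u k" and "0 \<le> r"
  shows "ennreal \<bar>\<Sum>j. x (n + 1 + j) / real (n + 1 + j)\<bar> \<le> ennreal r * tail_part u n"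
proof -
  have entry: "ennreal \<bar>x k / real k\<bar> \<le> ennreal r * ennreal (u k / real k)" if "1 \<le> k" for k
  proof -
    have "\<bar>x k / real k\<bar> \<le> r * (u k / real k)"
      using assms(1)[OF that] that by (simp add: field_simps)
    then show ?thesis using assms(2) by (metis ennreal_leI ennreal_mult')
  qed
  have "ennreal \<bar>\<Sum>j. x (n + 1 + j) / real (n + 1 + j)\<bar>
      \<le> (\<Sum>j. ennreal \<bar>x (n + 1 + j) / real (n + 1 + j)\<bar>)"
    by (rule ennreal_abs_suminf_le)
  also have "\<dots> \<le> (\<Sum>j. ennreal r * ennreal (u (n + 1 + j) / real (n + 1 + j)))"
    by (intro suminf_le entry summableI) simp
  finally show ?thesis by (simp add: tail_part_def)
qed

section \<open>Extremal sequences\<close>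

text \<open>
  The extremal sequences: they agree with \<open>u\<close> on the \<open>N\<close> columns right of the diagonal, while the
  value \<open>s\<close> on the diagonal is chosen as \<open>-u n\<close>, \<open>0\<close> or \<open>u n\<close>. Finite support puts them into the
  domain of \<open>C\<^sup>*\<close> for every \<open>u\<close>.
\<close>

definition truncation :: "(nat \<Rightarrow> real) \<Rightarrow> nat \<Rightarrow> nat \<Rightarrow> real \<Rightarrow> nat \<Rightarrow> real" where
  "truncation u n N s k = (if k = n then s else if n < k \<and> k \<le> n + N then u k else 0)"

lemma truncation_dom: "truncation u n N s \<in> dom_C_star"
  unfolding dom_C_star_def
  by (auto intro!: summable_finite[of "{..n + N}"] simp: truncation_def split: if_splits)

lemma truncation_abs_le:
  assumes "u \<in> ell_plus" and "\<bar>s\<bar> \<le> u n" and "1 \<le> k"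
  shows "\<bar>truncation u n N s k\<bar> \<le> u k"
  using assms by (auto simp: truncation_def ell_plus_def)

lemma truncation_nonneg:
  assumes "u \<in> ell_plus" and "0 \<le> s" and "1 \<le> k"
  shows "0 \<le> truncation u n N s k"
  using assms by (auto simp: truncation_def ell_plus_def)

lemma truncation_deviation:
  assumes "1 \<le> n"
  shows "deviation (truncation u n N s) n
    = (\<Sum>j<N. u (n + 1 + j) / real (n + 1 + j)) - (real n - 1) / real n * s"
proof -
  have "(\<Sum>j. truncation u n N s (n + 1 + j) / real (n + 1 + j))
      = (\<Sum>j<N. truncation u n N s (n + 1 + j) / real (n + 1 + j))"
    by (rule suminf_finite) (auto simp: truncation_def)
  also have "\<dots> = (\<Sum>j<N. u (n + 1 + j) / real (n + 1 + j))"
    by (rule sum.cong) (auto simp: truncation_def)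
  finally show ?thesis
    by (simp only: deviation_split[OF truncation_dom assms]) (simp add: truncation_def)
qed

lemma tail_part_eq_SUP:
  assumes "u \<in> ell_plus"
  shows "tail_part u n = (SUP N. ennreal (\<Sum>j<N. u (n + 1 + j) / real (n + 1 + j)))"
  unfolding tail_part_def suminf_eq_SUP
  using assms by (intro SUP_cong refl sum_ennreal) (auto simp: ell_plus_def)

text \<open>The value \<open>-u n\<close> on the diagonal makes both contributions to the row nonnegative, so that they
  add up in absolute value.\<close>

lemma real_row_attained:
  assumes u: "u \<in> ell_plus" and n: "1 \<le> n"
  shows "diagonal_part u n + tail_part u n
    \<le> (SUP x\<in>{x \<in> dom_C_star. \<forall>k\<ge>1. \<bar>x k\<bar> \<le> u k}. ennreal \<bar>deviation x n\<bar>)"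
    (is "_ \<le> ?S")
proof -
  let ?s = "\<lambda>N. \<Sum>j<N. u (n + 1 + j) / real (n + 1 + j)"
  have "diagonal_part u n + ennreal (?s N) \<le> ?S" for N
  proof -
    have nonneg: "0 \<le> ?s N" "0 \<le> (real n - 1) / real n * u n"
      using u n by (auto simp: ell_plus_def intro!: sum_nonneg)
    have "diagonal_part u n + ennreal (?s N)
        = ennreal \<bar>deviation (truncation u n N (- u n)) n\<bar>"
      using nonneg
      by (simp add: truncation_deviation[OF n] diagonal_part_def ennreal_plus[symmetric]
          del: ennreal_plus)
    also have "\<dots> \<le> ?S"
      using u n
      by (intro SUP_upper) (auto simp: truncation_dom ell_plus_def intro!: truncation_abs_le)
    finally show ?thesis .
  qed
  then have "(SUP N. diagonal_part u n + ennreal (?s N)) \<le> ?S"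
    by (intro SUP_least)
  then show ?thesis
    by (simp only: tail_part_eq_SUP[OF u]) (simp add: ennreal_SUP_add_right)
qed

text \<open>For nonnegative sequences the two contributions have opposite signs and would cancel; each is
  attained with the other one switched off (\<open>N = 0\<close> or \<open>s = 0\<close>).\<close>

lemma nonneg_row_attained:
  assumes u: "u \<in> ell_plus" and n: "1 \<le> n"
  shows "max (diagonal_part u n) (tail_part u n)
    \<le> (SUP x\<in>{x \<in> {x \<in> dom_C_star. \<forall>k\<ge>1. 0 \<le> x k}. \<forall>k\<ge>1. \<bar>x k\<bar> \<le> u k}.
         ennreal \<bar>deviation x n\<bar>)"
    (is "_ \<le> ?S")
proof -
  let ?s = "\<lambda>N. \<Sum>j<N. u (n + 1 + j) / real (n + 1 + j)"
  have test: "ennreal \<bar>deviation (truncation u n N s) n\<bar> \<le> ?S" if "0 \<le> s" "s \<le> u n" for N s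
    using truncation_abs_le[OF u, of s n _ N] truncation_nonneg[OF u, of s _ n N] that
    by (intro SUP_upper) (simp add: truncation_dom)
  have "diagonal_part u n = ennreal \<bar>deviation (truncation u n 0 (u n)) n\<bar>"
    using u n by (simp add: truncation_deviation diagonal_part_def ell_plus_def)
  also have "\<dots> \<le> ?S" using u n by (intro test) (auto simp: ell_plus_def)
  finally have diagonal: "diagonal_part u n \<le> ?S" .
  have "ennreal (?s N) \<le> ?S" for N
  proof -
    have "0 \<le> ?s N" using u by (auto simp: ell_plus_def intro!: sum_nonneg)
    then have "ennreal (?s N) = ennreal \<bar>deviation (truncation u n N 0) n\<bar>"
      by (simp add: truncation_deviation[OF n])
    also have "\<dots> \<le> ?S" using u n by (intro test) (auto simp: ell_plus_def)
    finally show ?thesis .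
  qed
  then have "tail_part u n \<le> ?S"
    by (simp only: tail_part_eq_SUP[OF u]) (intro SUP_least)
  with diagonal show ?thesis by simp
qed

section \<open>The three classes of sequences\<close>

lemma best_constant_real:
  assumes "u \<in> ell_plus"
  shows "best_constant dom_C_star u v (A_real (C_star - id_mat) u v)"
  unfolding A_real_eq
proof (rule best_constant_rowwise[OF assms _ real_row_attained[OF assms]])
  fix x r and n :: nat
  assume x: "x \<in> dom_C_star" and n: "1 \<le> n" and r: "0 \<le> r"
    and bound: "\<And>k. 1 \<le> k \<Longrightarrow> \<bar>x k\<bar> \<le> r * u k"
  let ?T = "\<Sum>j. x (n + 1 + j) / real (n + 1 + j)" and ?D = "(real n - 1) / real n * x n"
  have "ennreal \<bar>deviation x n\<bar> \<le> ennreal (\<bar>?D\<bar> + \<bar>?T\<bar>)"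
    unfolding deviation_split[OF x n]
    using abs_triangle_ineq4[of ?T ?D] by (intro ennreal_leI) (simp only: add.commute)
  also have "\<dots> = ennreal \<bar>?D\<bar> + ennreal \<bar>?T\<bar>"
    by (rule ennreal_plus) auto
  also have "\<dots> \<le> ennreal r * diagonal_part u n + ennreal r * tail_part u n"
    by (intro add_mono diagonal_le tail_le n r bound)
  finally show "ennreal \<bar>deviation x n\<bar> \<le> ennreal r * (diagonal_part u n + tail_part u n)"
    by (simp add: distrib_left)
qed

lemma best_constant_nonneg:
  assumes "u \<in> ell_plus"
  shows "best_constant {x \<in> dom_C_star. \<forall>k\<ge>1. 0 \<le> x k} u v (A_plus (C_star - id_mat) u v)"
  unfolding A_plus_eq
proof (rule best_constant_rowwise[OF assms _ nonneg_row_attained[OF assms]])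
  fix x r and n :: nat
  assume x: "x \<in> {x \<in> dom_C_star. \<forall>k\<ge>1. 0 \<le> x k}" and n: "1 \<le> n" and r: "0 \<le> r"
    and bound: "\<And>k. 1 \<le> k \<Longrightarrow> \<bar>x k\<bar> \<le> r * u k"
  let ?T = "\<Sum>j. x (n + 1 + j) / real (n + 1 + j)" and ?D = "(real n - 1) / real n * x n"
  let ?M = "max (diagonal_part u n) (tail_part u n)"
  have dom: "x \<in> dom_C_star" using x by simp
  have "0 \<le> ?T" using x by (intro suminf_nonneg summable_tail) auto
  moreover have "0 \<le> ?D" using x n by auto
  ultimately have "\<bar>deviation x n\<bar> \<le> \<bar>?D\<bar> \<or> \<bar>deviation x n\<bar> \<le> \<bar>?T\<bar>"
    unfolding deviation_split[OF dom n] by linarith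
  then have "ennreal \<bar>deviation x n\<bar> \<le> ennreal r * diagonal_part u n
      \<or> ennreal \<bar>deviation x n\<bar> \<le> ennreal r * tail_part u n"
    using diagonal_le[of n x r u] tail_le[of x r u n] n r bound
    by (meson ennreal_leI order_trans)
  moreover have "ennreal r * diagonal_part u n \<le> ennreal r * ?M"
    and "ennreal r * tail_part u n \<le> ennreal r * ?M"
    by (auto intro!: mult_left_mono)
  ultimately show "ennreal \<bar>deviation x n\<bar> \<le> ennreal r * ?M"
    by (meson order_trans)
qed

text \<open>Otherwise \<open>x k / k \<ge> x m / k\<close> for \<open>k \<ge> m\<close>, and the harmonic series would converge.\<close>

lemma nondecreasing_dom_C_star_eq_zero:
  assumes x: "x \<in> dom_C_star" and nonneg: "\<And>k. 1 \<le> k \<Longrightarrow> 0 \<le> x k"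
    and mono: "mono_on {1..} x" and m: "1 \<le> m"
  shows "x m = 0"
proof (rule ccontr)
  assume "x m \<noteq> 0"
  with nonneg[OF m] have pos: "0 < x m" by simp
  have "summable (\<lambda>j. inverse (real (j + (m + 1))))"
  proof (rule summable_comparison_test')
    show "summable (\<lambda>j. (1 / x m) * (x (m + 1 + j) / real (m + 1 + j)))"
      by (intro summable_mult summable_tail x)
    fix j :: nat
    have "x m \<le> x (m + 1 + j)" using mono m by (auto intro: mono_onD)
    then show "norm (inverse (real (j + (m + 1))))
        \<le> (1 / x m) * (x (m + 1 + j) / real (m + 1 + j))"
      using pos by (simp add: inverse_eq_divide divide_right_mono add_ac flip: divide_divide_eq_left)
  qed
  then have "summable (\<lambda>j. inverse (real j))"
    by (subst (asm) summable_iff_shift)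
  then show False using not_summable_harmonic[where 'a = real] by simp
qed

lemma best_constant_nondecreasing:
  "best_constant {x \<in> dom_C_star. (\<forall>k\<ge>1. 0 \<le> x k) \<and> mono_on {1..} x} u v 0"
  unfolding best_constant_def
proof (intro conjI ballI allI impI)
  fix x assume "x \<in> {x \<in> dom_C_star. (\<forall>k\<ge>1. 0 \<le> x k) \<and> mono_on {1..} x}"
  then have zero: "x k = 0" if "1 \<le> k" for k
    using that nondecreasing_dom_C_star_eq_zero[of x k] by auto
  have "lhs_sup v x \<le> 0"
    unfolding lhs_sup_def linf_norm_def by (rule SUP_least) (simp add: zero)
  then show "ineq_holds u v 0 x" by (simp add: ineq_holds_def)
qed simp

theorem corollary3p10:
  fixes u v :: "nat \<Rightarrow> real"
  assumes "u \<in> ell_plus" and "v \<in> ell_plus"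
  shows "best_constant dom_C_star u v (A_real (C_star - id_mat) u v)
    \<and> best_constant {x \<in> dom_C_star. \<forall>k\<ge>1. 0 \<le> x k} u v (A_plus (C_star - id_mat) u v)
    \<and> best_constant {x \<in> dom_C_star. (\<forall>k\<ge>1. 0 \<le> x k) \<and> mono_on {1..} x} u v 0
    \<and> A_real (C_star - id_mat) u v =
        (SUP n\<in>{1..}. ennreal (v n) *
          (ennreal ((real n - 1) / real n * u n)
            + (\<Sum>j. ennreal (u (n + 1 + j) / real (n + 1 + j)))))
    \<and> A_plus (C_star - id_mat) u v =
        (SUP n\<in>{1..}. ennreal (v n) *
          max (ennreal ((real n - 1) / real n * u n))
            (\<Sum>j. ennreal (u (n + 1 + j) / real (n + 1 + j))))"
  using best_constant_real[OF assms(1)] best_constant_nonneg[OF assms(1)]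
    best_constant_nondecreasing A_real_eq A_plus_eq
  unfolding diagonal_part_def tail_part_def by blast

end
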